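(* Let $\Pi$ be a (P)-problem and let APPR be a $\rho$-dual oblivious algorithm for $\Pi$ (with constant $\delta$), whose associated dual solution $y$ is available. Then for any instance of $\Pi$ whose LP relaxation has optimal value $\mathrm{OPT}^*$, Algorithm 2 (described in the context) outputs a family $\mathcal{G}\cup\mathcal{A}$ of sets covering the ground set with \[ w(\mathcal{G}\cup\mathcal{A})\le(\ln\rho+1)\,\mathrm{OPT}^*+\delta+w_{\max}, \] where $w_{\max}=\max_{C\in\mathcal{C}}w_C$ and $w(\cdot)$ denotes total cost.
   Context: A (P)-problem is a problem whose instances are weighted set cover instances: a family $\mathcal{C}$ of subsets of a ground set $I=\bigcup_{C\in\mathcal{C}}C$ with costs $w_C\ge 0$; the goal is to choose sets covering $I$ of minimum total cost, i.e. the integer program (P): $\min\sum_C w_Cx_C$ s.t. $\sum_{C\ni i}x_C\ge 1$ for all $i\in I$, $x_C\in\{0,1\}$; its LP relaxation replaces $x_C\in\{0,1\}$ by $x_C\ge 0$. The dual (D) of the relaxation is $\max\sum_{i\in I}y_i$ s.t. $\sum_{i\in C}y_i\le w_C$ for all $C\in\mathcal{C}$, $y\ge 0$. For $S\subseteq I$, the restriction is $\mathcal{C}|_S=\{C\cap S:C\in\mathcal{C}\}$ (with the same costs). An algorithm $A$ is $\rho$-dual oblivious if there is a constant $\delta$ such that for every instance $\mathcal{C}$ there is a feasible solution $y$ of (D) with $A(\mathcal{C}|_S)\le\rho\sum_{i\in S}y_i+\delta$ for all $S\subseteq I$, where $A(\cdot)$ is the cost of $A$'s output. Algorithm 2: (1)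 find an optimal solution $x^*$ of the LP relaxation of (P), with value $\mathrm{OPT}^*$. (2) Let $\mathcal{C}^+=\{C:x^*_C>0\}$, $\mathcal{G}=\emptyset$, $S=I$. While $\sum_{C\in\mathcal{G}}w_C<\ln\rho\cdot\mathrm{OPT}^*$: find $C\in\mathcal{C}^+$ maximizing $\frac{1}{w_C}\sum_{i\in S\cap C}y_i$ (with $y$ the dual solution from dual obliviousness of APPR), and set $\mathcal{G}\leftarrow\mathcal{G}\cup\{C\}$, $S\leftarrow S\setminus C$. (3) Apply APPR to the residual instance $\mathcal{C}|_S$, obtaining solution $\mathcal{A}$. Return $\mathcal{G}\cup\mathcal{A}$.
   Formalization: Assumes ρ ≥ 1 (the bound can fail for ρ < 1). As the while loop can run forever when w(C⁺) < ln ρ·OPT*, Algorithm 2 is amended: each step picks a maximizer outside G, and the loop also stops once G contains all of C⁺. Instances are finite with a nonempty family. *)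

theory Defs
  imports Complex_Main "HOL-Library.While_Combinator"
begin

text \<open>Families are indexed: the restriction to a subset of the ground set may make two members
  equal, or empty, while each of them keeps its own cost. Subfamilies are sets of indices, so a
  subfamily of a restricted instance is at the same time a subfamily of the original one.\<close>

record ('k, 'i) cover_inst =
  idx :: "'k set"
  elems :: "'k \<Rightarrow> 'i set"
  cost :: "'k \<Rightarrow> real"

definition ground :: "('k, 'i) cover_inst \<Rightarrow> 'i set" where
  "ground c = (\<Union>k\<in>idx c. elems c k)"

definition set_cover_instance :: "('k, 'i) cover_inst \<Rightarrow> bool" where
  "set_cover_instance c \<longleftrightarrow>
     finite (idx c) \<and> (\<forall>k\<in>idx c. finite (elems c k)) \<and> (\<forall>k\<in>idx c. 0 \<le> cost c k)"

definition P_problem :: "('k, 'i) cover_inst set \<Rightarrow> bool" where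
  "P_problem \<Pi> \<longleftrightarrow> (\<forall>c\<in>\<Pi>. set_cover_instance c)"

definition restrict_inst :: "('k, 'i) cover_inst \<Rightarrow> 'i set \<Rightarrow> ('k, 'i) cover_inst" where
  "restrict_inst c S = c\<lparr>elems := \<lambda>k. elems c k \<inter> S\<rparr>"

definition total_cost :: "('k, 'i) cover_inst \<Rightarrow> 'k set \<Rightarrow> real" where
  "total_cost c A = (\<Sum>k\<in>A. cost c k)"

definition is_cover :: "('k, 'i) cover_inst \<Rightarrow> 'k set \<Rightarrow> bool" where
  "is_cover c A \<longleftrightarrow> A \<subseteq> idx c \<and> ground c \<subseteq> (\<Union>k\<in>A. elems c k)"

definition lp_feasible :: "('k, 'i) cover_inst \<Rightarrow> ('k \<Rightarrow> real) \<Rightarrow> bool" where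
  "lp_feasible c x \<longleftrightarrow>
     (\<forall>k\<in>idx c. 0 \<le> x k) \<and> (\<forall>i\<in>ground c. (\<Sum>k | k \<in> idx c \<and> i \<in> elems c k. x k) \<ge> 1)"

definition lp_cost :: "('k, 'i) cover_inst \<Rightarrow> ('k \<Rightarrow> real) \<Rightarrow> real" where
  "lp_cost c x = (\<Sum>k\<in>idx c. cost c k * x k)"

definition lp_optimal :: "('k, 'i) cover_inst \<Rightarrow> ('k \<Rightarrow> real) \<Rightarrow> bool" where
  "lp_optimal c x \<longleftrightarrow> lp_feasible c x \<and> (\<forall>x'. lp_feasible c x' \<longrightarrow> lp_cost c x \<le> lp_cost c x')"

definition dual_feasible :: "('k, 'i) cover_inst \<Rightarrow> ('i \<Rightarrow> real) \<Rightarrow> bool" where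
  "dual_feasible c y \<longleftrightarrow>
     (\<forall>i\<in>ground c. 0 \<le> y i) \<and> (\<forall>k\<in>idx c. (\<Sum>i\<in>elems c k. y i) \<le> cost c k)"

text \<open>An algorithm maps an instance to the subfamily it returns. Since dual obliviousness runs it
  on restrictions, it has to return covers of all restrictions of instances of the problem; the
  problem itself need not be closed under restriction.\<close>

definition algorithm_for ::
  "('k, 'i) cover_inst set \<Rightarrow> (('k, 'i) cover_inst \<Rightarrow> 'k set) \<Rightarrow> bool" where
  "algorithm_for \<Pi> A \<longleftrightarrow>
     (\<forall>c\<in>\<Pi>. \<forall>S\<subseteq>ground c. is_cover (restrict_inst c S) (A (restrict_inst c S)))"

definition oblivious_dual ::
  "(('k, 'i) cover_inst \<Rightarrow> 'k set) \<Rightarrow> real \<Rightarrow> real \<Rightarrow> ('k, 'i) cover_inst \<Rightarrow> ('i \<Rightarrow> real) \<Rightarrow> bool" where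
  "oblivious_dual A \<rho> \<delta> c y \<longleftrightarrow> dual_feasible c y \<and>
     (\<forall>S\<subseteq>ground c.
        total_cost (restrict_inst c S) (A (restrict_inst c S)) \<le> \<rho> * (\<Sum>i\<in>S. y i) + \<delta>)"

definition dual_oblivious ::
  "('k, 'i) cover_inst set \<Rightarrow> (('k, 'i) cover_inst \<Rightarrow> 'k set) \<Rightarrow> real \<Rightarrow> real \<Rightarrow> bool" where
  "dual_oblivious \<Pi> A \<rho> \<delta> \<longleftrightarrow> (\<forall>c\<in>\<Pi>. \<exists>y. oblivious_dual A \<rho> \<delta> c y)"

definition support :: "('k, 'i) cover_inst \<Rightarrow> ('k \<Rightarrow> real) \<Rightarrow> 'k set" where
  "support c x = {k \<in> idx c. x k > 0}"

text \<open>For a member of cost 0, dual feasibility forces the numerator to be 0 as well; the quotient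
  is then read as 0.\<close>

definition density :: "('k, 'i) cover_inst \<Rightarrow> ('i \<Rightarrow> real) \<Rightarrow> 'i set \<Rightarrow> 'k \<Rightarrow> real" where
  "density c y S k = 1 / cost c k * (\<Sum>i\<in>S \<inter> elems c k. y i)"

text \<open>A rule for the greedy selection: \<open>pick G\<close> is the member selected when \<open>G\<close> has been
  selected so far. Members of \<open>G\<close> have density 0, so they can only be maximizers when all
  densities are 0, and selecting one of them again would change neither \<open>G\<close> nor \<open>S\<close>. Such
  idle iterations are excluded by \<open>pick G \<notin> G\<close>; ties are otherwise broken arbitrarily.\<close>

definition greedy_choice ::
  "('k, 'i) cover_inst \<Rightarrow> ('k \<Rightarrow> real) \<Rightarrow> ('i \<Rightarrow> real) \<Rightarrow> ('k set \<Rightarrow> 'k) \<Rightarrow> bool" where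
  "greedy_choice c x y pick \<longleftrightarrow>
     (\<forall>G. G \<subset> support c x \<longrightarrow> pick G \<notin> G \<and>
        is_arg_max (density c y (ground c - (\<Union>k\<in>G. elems c k))) (\<lambda>k. k \<in> support c x) (pick G))"

lemma greedy_choice_exists:
  assumes c: "set_cover_instance c" and y: "dual_feasible c y"
  shows "\<exists>pick. greedy_choice c x y pick"
proof -
  have "\<exists>k. k \<notin> G \<and>
      is_arg_max (density c y (ground c - (\<Union>k\<in>G. elems c k))) (\<lambda>k. k \<in> support c x) k"
    if G: "G \<subset> support c x" for G
  proof -
    let ?d = "density c y (ground c - (\<Union>k\<in>G. elems c k))"
    have fin: "finite (support c x - G)"
      using c by (auto simp: support_def set_cover_instance_def)
    have ne: "support c x - G \<noteq> {}" using G by blast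
    have "Max (?d ` (support c x - G)) \<in> ?d ` (support c x - G)"
      using fin ne by (intro Max_in) auto
    then obtain k where kin: "k \<in> support c x - G" and "?d k = Max (?d ` (support c x - G))"
      by auto
    then have "?d j \<le> ?d k" if "j \<in> support c x - G" for j
      using fin that by simp
    then have k: "is_arg_max ?d (\<lambda>j. j \<in> support c x - G) k"
      using kin unfolding is_arg_max_def by (meson not_less)
    have k0: "0 \<le> ?d k"
      using k c y unfolding density_def is_arg_max_def support_def set_cover_instance_def
        dual_feasible_def
      by (auto intro!: divide_nonneg_nonneg sum_nonneg)
    have g0: "?d j = 0" if "j \<in> G" for j
    proof -
      have "(ground c - (\<Union>k\<in>G. elems c k)) \<inter> elems c j = {}" using that by blast
      then show ?thesis by (simp add: density_def)
    qed
    show ?thesis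
      using k k0 g0 unfolding is_arg_max_def by (metis DiffD1 DiffD2 DiffI not_less)
  qed
  then show ?thesis unfolding greedy_choice_def by metis
qed

text \<open>The result is the pair of the greedy part and the part found by \<open>A\<close>, or \<open>None\<close> if the loop
  diverges. The members in the support cover the ground set but may cost less than the budget
  \<open>ln \<rho> * OPT\<close>; the loop then stops once all of them are selected, as no further
  iteration could change the state.\<close>

definition greedy_then_apply ::
  "real \<Rightarrow> (('k, 'i) cover_inst \<Rightarrow> 'k set) \<Rightarrow> ('k set \<Rightarrow> 'k) \<Rightarrow> ('k, 'i) cover_inst \<Rightarrow> ('k \<Rightarrow> real)
     \<Rightarrow> ('k set \<times> 'k set) option" where
  "greedy_then_apply \<rho> A pick c x =
     map_option (\<lambda>(G, S). (G, A (restrict_inst c S)))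
       (while_option
          (\<lambda>(G, S). total_cost c G < ln \<rho> * lp_cost c x \<and> \<not> support c x \<subseteq> G)
          (\<lambda>(G, S). (G \<union> {pick G}, S - elems c (pick G)))
          ({}, ground c))"

definition max_cost :: "('k, 'i) cover_inst \<Rightarrow> real" where
  "max_cost c = Max (cost c ` idx c)"

end

theory Submission
  imports Defs
begin

text \<open>Let \<open>Y(S)\<close> be the sum of \<open>y\<close> over \<open>S\<close>. Averaging with the weights \<open>w_C x_C / OPT\<close> shows that
  some member \<open>C\<close> of the support satisfies \<open>Y(S \<inter> C) / w_C \<ge> Y(S) / OPT\<close>, so a greedy step multiplies
  \<open>Y(S)\<close> by at most \<open>1 - w_C / OPT \<le> exp (- w_C / OPT)\<close>. As \<open>Y(I) \<le> OPT\<close> by weak duality,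
  \<open>Y(S) \<le> OPT * exp (- w(G) / OPT)\<close> throughout the loop. When the budget \<open>ln \<rho> * OPT\<close> is used up,
  \<open>\<rho> * Y(S) \<le> OPT\<close>, and the last step exceeds the budget by at most the maximum cost.\<close>

section \<open>Restrictions and total costs\<close>

lemma finite_ground: "set_cover_instance c \<Longrightarrow> finite (ground c)"
  by (auto simp: set_cover_instance_def ground_def)

lemma ground_restrict_inst: "S \<subseteq> ground c \<Longrightarrow> ground (restrict_inst c S) = S"
  by (auto simp: ground_def restrict_inst_def)

lemma total_cost_restrict_inst [simp]: "total_cost (restrict_inst c S) A = total_cost c A"
  by (simp add: total_cost_def restrict_inst_def)

text \<open>\<open>G\<close> and \<open>A\<close> may overlap, since a restricted instance keeps all
  indices and APPR may return a member selected before. With nonnegative costs the overlap only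
  helps.\<close>

lemma total_cost_Un_le:
  assumes "set_cover_instance c" "G \<subseteq> idx c" "A \<subseteq> idx c"
  shows "total_cost c (G \<union> A) \<le> total_cost c G + total_cost c A"
proof -
  have "finite G" "finite A" and "0 \<le> sum (cost c) (G \<inter> A)"
    using assms by (auto simp: set_cover_instance_def intro: finite_subset intro!: sum_nonneg)
  then show ?thesis
    using sum.union_inter[of G A "cost c"] by (simp add: total_cost_def)
qed

lemma cost_le_max_cost: "set_cover_instance c \<Longrightarrow> k \<in> idx c \<Longrightarrow> cost c k \<le> max_cost c"
  by (simp add: max_cost_def set_cover_instance_def)

lemma max_cost_nonneg:
  assumes "set_cover_instance c" "idx c \<noteq> {}"
  shows "0 \<le> max_cost c"
  using assms cost_le_max_cost[OF assms(1)]
  by (metis all_not_in_conv order_trans set_cover_instance_def)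

section \<open>The LP relaxation and its dual\<close>

text \<open>A sum that is at least 1 has a positive term. This is why nothing is left to cover once
  the whole support is selected.\<close>

lemma support_covers:
  assumes "lp_feasible c x"
  shows "ground c \<subseteq> (\<Union>k\<in>support c x. elems c k)"
proof
  fix i assume "i \<in> ground c"
  then have "0 < (\<Sum>k | k \<in> idx c \<and> i \<in> elems c k. x k)"
    using assms unfolding lp_feasible_def by (meson less_le_trans zero_less_one)
  then obtain k where "k \<in> idx c" "i \<in> elems c k" "0 < x k"
    by (metis (mono_tags, lifting) mem_Collect_eq not_less sum_nonpos)
  then show "i \<in> (\<Union>k\<in>support c x. elems c k)"
    by (auto simp: support_def)
qed

lemma lp_cost_support:
  assumes "set_cover_instance c" "lp_feasible c x"
  shows "lp_cost c x = (\<Sum>k\<in>support c x. cost c k * x k)"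
  unfolding lp_cost_def
  by (rule sum.mono_neutral_right)
    (use assms in \<open>auto simp: support_def set_cover_instance_def lp_feasible_def order.order_iff_strict\<close>)

lemma lp_cost_nonneg:
  assumes "set_cover_instance c" "lp_feasible c x"
  shows "0 \<le> lp_cost c x"
  using assms
  by (auto simp: lp_cost_def set_cover_instance_def lp_feasible_def intro!: sum_nonneg)

text \<open>Each \<open>y i\<close> is distributed over the members containing \<open>i\<close>,
  with weights \<open>x k\<close> of total at least 1; then the order of summation is
  exchanged.\<close>

lemma dual_sum_le_fractional_cover:
  assumes c: "set_cover_instance c" and x: "lp_feasible c x" and y: "dual_feasible c y"
    and S: "S \<subseteq> ground c"
  shows "(\<Sum>i\<in>S. y i) \<le> (\<Sum>k\<in>support c x. x k * (\<Sum>i\<in>S \<inter> elems c k. y i))"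
proof -
  have fin: "finite S" "finite (idx c)"
    using c S finite_ground by (auto simp: set_cover_instance_def intro: finite_subset)
  have "y i \<le> (\<Sum>k\<in>idx c. if i \<in> elems c k then x k * y i else 0)" if "i \<in> S" for i
  proof -
    have "1 * y i \<le> (\<Sum>k | k \<in> idx c \<and> i \<in> elems c k. x k) * y i"
      using x y S that by (intro mult_right_mono) (auto simp: lp_feasible_def dual_feasible_def)
    also have "\<dots> = (\<Sum>k\<in>idx c. if i \<in> elems c k then x k * y i else 0)"
      using fin by (auto simp: sum_distrib_right sum.inter_filter intro!: sum.cong)
    finally show ?thesis by simp
  qed
  then have "(\<Sum>i\<in>S. y i) \<le> (\<Sum>i\<in>S. \<Sum>k\<in>idx c. if i \<in> elems c k then x k * y i else 0)"
    by (rule sum_mono)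
  also have "\<dots> = (\<Sum>k\<in>idx c. \<Sum>i\<in>S. if i \<in> elems c k then x k * y i else 0)"
    by (rule sum.swap)
  also have "\<dots> = (\<Sum>k\<in>idx c. x k * (\<Sum>i\<in>S \<inter> elems c k. y i))"
    using fin by (auto simp: sum_distrib_left sum.inter_restrict intro!: sum.cong)
  also have "\<dots> = (\<Sum>k\<in>support c x. x k * (\<Sum>i\<in>S \<inter> elems c k. y i))"
    by (rule sum.mono_neutral_right)
      (use fin x in \<open>auto simp: support_def lp_feasible_def order.order_iff_strict\<close>)
  finally show ?thesis .
qed

lemma dual_sum_nonneg:
  assumes "dual_feasible c y" "S \<subseteq> ground c"
  shows "0 \<le> (\<Sum>i\<in>S. y i)"
  using assms by (auto simp: dual_feasible_def intro!: sum_nonneg)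

lemma dual_sum_Int_elems_le_cost:
  assumes c: "set_cover_instance c" and y: "dual_feasible c y" and k: "k \<in> idx c"
  shows "(\<Sum>i\<in>S \<inter> elems c k. y i) \<le> cost c k"
proof -
  have "(\<Sum>i\<in>S \<inter> elems c k. y i) \<le> (\<Sum>i\<in>elems c k. y i)"
    using c y k
    by (intro sum_mono2) (auto simp: set_cover_instance_def dual_feasible_def ground_def)
  also have "\<dots> \<le> cost c k" using y k by (simp add: dual_feasible_def)
  finally show ?thesis .
qed

text \<open>Clears the denominator without assuming a positive cost. If the cost is 0, the dual
  constraint squeezes the sum between 0 and 0.\<close>

lemma density_mult_cost:
  assumes c: "set_cover_instance c" and y: "dual_feasible c y" and k: "k \<in> idx c"
  shows "density c y S k * cost c k = (\<Sum>i\<in>S \<inter> elems c k. y i)"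
proof (cases "cost c k = 0")
  case True
  have "0 \<le> (\<Sum>i\<in>S \<inter> elems c k. y i)"
    by (rule dual_sum_nonneg[OF y]) (use k in \<open>auto simp: ground_def\<close>)
  then show ?thesis
    using True dual_sum_Int_elems_le_cost[OF assms, of S] by simp
qed (simp add: density_def)

text \<open>The fractional cover bound for the whole ground set, followed by the dual constraints
  weighted with \<open>x\<close>.\<close>

lemma weak_duality:
  assumes c: "set_cover_instance c" and x: "lp_feasible c x" and y: "dual_feasible c y"
  shows "(\<Sum>i\<in>ground c. y i) \<le> lp_cost c x"
proof -
  have "(\<Sum>i\<in>ground c. y i) \<le> (\<Sum>k\<in>support c x. x k * (\<Sum>i\<in>ground c \<inter> elems c k. y i))"
    by (rule dual_sum_le_fractional_cover[OF assms order_refl])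
  also have "\<dots> \<le> (\<Sum>k\<in>support c x. x k * cost c k)"
    by (intro sum_mono mult_left_mono dual_sum_Int_elems_le_cost[OF c y])
      (auto simp: support_def)
  also have "\<dots> = lp_cost c x"
    by (simp add: lp_cost_support[OF c x] mult.commute)
  finally show ?thesis .
qed

section \<open>The greedy choice and the decay of the uncovered dual value\<close>

text \<open>The averaging argument: the maximum density over the support dominates the average with
  weights \<open>cost c k * x k\<close>. The product form avoids dividing by costs or by the LP
  value.\<close>

lemma dual_sum_le_max_density:
  assumes c: "set_cover_instance c" and x: "lp_feasible c x" and y: "dual_feasible c y"
    and S: "S \<subseteq> ground c"
    and p: "is_arg_max (density c y S) (\<lambda>k. k \<in> support c x) p"
  shows "(\<Sum>i\<in>S. y i) \<le> density c y S p * lp_cost c x"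
proof -
  have le: "(\<Sum>i\<in>S \<inter> elems c k. y i) \<le> density c y S p * cost c k" if "k \<in> support c x" for k
  proof -
    have k: "k \<in> idx c" using that by (simp add: support_def)
    have "density c y S k * cost c k \<le> density c y S p * cost c k"
      using p that k c
      by (intro mult_right_mono) (auto simp: is_arg_max_def set_cover_instance_def not_less)
    then show ?thesis by (simp add: density_mult_cost[OF c y k])
  qed
  have "(\<Sum>i\<in>S. y i) \<le> (\<Sum>k\<in>support c x. x k * (\<Sum>i\<in>S \<inter> elems c k. y i))"
    by (rule dual_sum_le_fractional_cover[OF c x y S])
  also have "\<dots> \<le> (\<Sum>k\<in>support c x. x k * (density c y S p * cost c k))"
    by (intro sum_mono mult_left_mono le) (auto simp: support_def)
  also have "\<dots> = density c y S p * lp_cost c x"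
    by (simp add: lp_cost_support[OF c x] sum_distrib_left mult_ac)
  finally show ?thesis .
qed

lemma greedy_step_decay:
  assumes c: "set_cover_instance c" and x: "lp_feasible c x" and y: "dual_feasible c y"
    and S: "S \<subseteq> ground c" and OPT: "0 < lp_cost c x"
    and p: "is_arg_max (density c y S) (\<lambda>k. k \<in> support c x) p"
  shows "(\<Sum>i\<in>S - elems c p. y i) \<le> (\<Sum>i\<in>S. y i) * exp (- cost c p / lp_cost c x)"
proof -
  let ?Y = "\<Sum>i\<in>S. y i" and ?OPT = "lp_cost c x"
  have p_idx: "p \<in> idx c" using p by (simp add: is_arg_max_def support_def)
  have "?Y / ?OPT \<le> density c y S p"
    using dual_sum_le_max_density[OF c x y S p] OPT by (simp add: field_simps)
  then have "?Y / ?OPT * cost c p \<le> density c y S p * cost c p"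
    using c p_idx by (intro mult_right_mono) (auto simp: set_cover_instance_def)
  then have "?Y / ?OPT * cost c p \<le> (\<Sum>i\<in>S \<inter> elems c p. y i)"
    by (simp add: density_mult_cost[OF c y p_idx])
  moreover have "?Y = (\<Sum>i\<in>S \<inter> elems c p. y i) + (\<Sum>i\<in>S - elems c p. y i)"
    using finite_subset[OF S finite_ground[OF c]] by (rule sum.Int_Diff)
  ultimately have "(\<Sum>i\<in>S - elems c p. y i) \<le> ?Y - ?Y / ?OPT * cost c p"
    by linarith
  also have "\<dots> = ?Y * (1 + - cost c p / ?OPT)"
    by (simp add: algebra_simps)
  \<comment> \<open>\<open>1 + t \<le> exp t\<close> holds for every real \<open>t\<close>, so
    \<open>cost c p\<close> may well exceed the LP value here.\<close>
  also have "\<dots> \<le> ?Y * exp (- cost c p / ?OPT)"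
    using dual_sum_nonneg[OF y S] by (intro mult_left_mono exp_ge_add_one_self)
  finally show ?thesis .
qed

section \<open>The loop: invariant and termination\<close>

text \<open>\<open>B\<close> stands for the budget, and \<open>max_cost c\<close> allows for the
  overshoot of the last step. If the LP value is 0, the last conjunct says that the dual sum is at
  most 0.\<close>

definition greedy_invariant ::
  "('k, 'i) cover_inst \<Rightarrow> ('k \<Rightarrow> real) \<Rightarrow> ('i \<Rightarrow> real) \<Rightarrow> real \<Rightarrow> 'k set \<Rightarrow> 'i set \<Rightarrow> bool" where
  "greedy_invariant c x y B G S \<longleftrightarrow>
     G \<subseteq> support c x \<and> S = ground c - (\<Union>k\<in>G. elems c k) \<and>
     total_cost c G \<le> B + max_cost c \<and>
     (\<Sum>i\<in>S. y i) \<le> lp_cost c x * exp (- total_cost c G / lp_cost c x)"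

text \<open>At total cost 0 the exponential is 1, and the decay bound is weak duality.\<close>

lemma greedy_invariant_init:
  assumes "set_cover_instance c" "lp_feasible c x" "dual_feasible c y" "idx c \<noteq> {}" "0 \<le> B"
  shows "greedy_invariant c x y B {} (ground c)"
  using weak_duality[OF assms(1-3)] max_cost_nonneg[OF assms(1,4)] assms(5)
  by (simp add: greedy_invariant_def total_cost_def)

lemma greedy_invariant_step:
  assumes c: "set_cover_instance c" and x: "lp_feasible c x" and y: "dual_feasible c y"
    and pick: "greedy_choice c x y pick"
    and inv: "greedy_invariant c x y B G S"
    and OPT: "0 < lp_cost c x" and budget: "total_cost c G < B" and G: "\<not> support c x \<subseteq> G"
  shows "greedy_invariant c x y B (G \<union> {pick G}) (S - elems c (pick G))"
    and "pick G \<in> support c x - G"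
proof -
  let ?p = "pick G" and ?OPT = "lp_cost c x"
  have Gsub: "G \<subseteq> support c x" and S: "S = ground c - (\<Union>k\<in>G. elems c k)"
    and Y: "(\<Sum>i\<in>S. y i) \<le> ?OPT * exp (- total_cost c G / ?OPT)"
    using inv by (auto simp: greedy_invariant_def)
  then have p: "?p \<notin> G" "is_arg_max (density c y S) (\<lambda>k. k \<in> support c x) ?p"
    using pick G by (auto simp: greedy_choice_def)
  then show p_supp: "?p \<in> support c x - G" by (simp add: is_arg_max_def)
  have p_idx: "?p \<in> idx c" and "finite G"
    using p_supp Gsub c by (auto simp: support_def set_cover_instance_def intro: finite_subset)
  \<comment> \<open>The costs add up exactly because \<open>pick G\<close> is new.\<close>
  then have cost: "total_cost c (G \<union> {?p}) = total_cost c G + cost c ?p"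
    using p by (simp add: total_cost_def)
  have "(\<Sum>i\<in>S - elems c ?p. y i) \<le> (\<Sum>i\<in>S. y i) * exp (- cost c ?p / ?OPT)"
    by (rule greedy_step_decay[OF c x y _ OPT p(2)]) (auto simp: S)
  also have "\<dots> \<le> ?OPT * exp (- total_cost c G / ?OPT) * exp (- cost c ?p / ?OPT)"
    using Y by (rule mult_right_mono) simp
  also have "\<dots> = ?OPT * exp (- total_cost c (G \<union> {?p}) / ?OPT)"
    unfolding cost by (simp add: mult_exp_exp diff_divide_distrib)
  finally have "(\<Sum>i\<in>S - elems c ?p. y i) \<le> ?OPT * exp (- total_cost c (G \<union> {?p}) / ?OPT)" .
  \<comment> \<open>The budget was not yet reached before this step, so a single member accounts for
    the whole overshoot.\<close>
  moreover have "total_cost c (G \<union> {?p}) \<le> B + max_cost c"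
    using budget cost cost_le_max_cost[OF c p_idx] by linarith
  moreover have "G \<union> {?p} \<subseteq> support c x" using Gsub p_supp by blast
  moreover have "S - elems c ?p = ground c - (\<Union>k\<in>G \<union> {?p}. elems c k)" using S by blast
  ultimately show "greedy_invariant c x y B (G \<union> {?p}) (S - elems c ?p)"
    unfolding greedy_invariant_def by blast
qed

text \<open>The number of unselected members of the support drops in every iteration.
  \<open>1 \<le> \<rho>\<close> makes the budget nonnegative, as the initial invariant
  requires.\<close>

lemma greedy_loop_terminates:
  assumes c: "set_cover_instance c" and ne: "idx c \<noteq> {}" and \<rho>: "1 \<le> \<rho>"
    and x: "lp_feasible c x" and y: "dual_feasible c y" and pick: "greedy_choice c x y pick"
  obtains G S where
    "while_option
       (\<lambda>(G, S). total_cost c G < ln \<rho> * lp_cost c x \<and> \<not> support c x \<subseteq> G)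
       (\<lambda>(G, S). (G \<union> {pick G}, S - elems c (pick G))) ({}, ground c) = Some (G, S)"
    "greedy_invariant c x y (ln \<rho> * lp_cost c x) G S"
    "ln \<rho> * lp_cost c x \<le> total_cost c G \<or> support c x \<subseteq> G"
proof -
  let ?B = "ln \<rho> * lp_cost c x"
  let ?b = "\<lambda>(G, S). total_cost c G < ?B \<and> \<not> support c x \<subseteq> G"
  let ?f = "\<lambda>(G, S). (G \<union> {pick G}, S - elems c (pick G))"
  let ?I = "\<lambda>(G, S). greedy_invariant c x y ?B G S"
  have OPT: "0 \<le> lp_cost c x" by (rule lp_cost_nonneg[OF c x])
  have fin: "finite (support c x)"
    using c by (simp add: support_def set_cover_instance_def)
  have step: "?I (?f s) \<and> card (support c x - fst (?f s)) < card (support c x - fst s)"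
    if I: "?I s" and b: "?b s" for s
  proof -
    obtain G S where s: "s = (G, S)" by force
    have "total_cost c G < ?B" "\<not> support c x \<subseteq> G" using b s by auto
    moreover have "0 \<le> total_cost c G"
      using I s c
      by (auto simp: greedy_invariant_def total_cost_def support_def set_cover_instance_def
          intro!: sum_nonneg)
    \<comment> \<open>An LP value of 0 would give a budget of 0, and no nonnegative cost lies
      strictly below that.\<close>
    ultimately have "0 < lp_cost c x" using OPT by (cases "lp_cost c x = 0") auto
    then have inv: "greedy_invariant c x y ?B (G \<union> {pick G}) (S - elems c (pick G))"
      and p: "pick G \<in> support c x - G"
      using greedy_invariant_step[OF c x y pick, of ?B G S] I b s by auto
    have "card (support c x - (G \<union> {pick G})) < card (support c x - G)"
      using fin p by (intro psubset_card_mono) auto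
    then show ?thesis using inv s by simp
  qed
  have init: "?I ({}, ground c)"
    using greedy_invariant_init[OF c x y ne] \<rho> OPT by simp
  have "\<exists>t. while_option ?b ?f ({}, ground c) = Some t"
    by (rule measure_while_option_Some[of ?I ?b ?f "\<lambda>s. card (support c x - fst s)", OF step init])
  then obtain t where t: "while_option ?b ?f ({}, ground c) = Some t" ..
  have "?I t" by (rule while_option_rule[of ?I ?b ?f, OF conjunct1[OF step] t init])
  moreover have "\<not> ?b t" using while_option_stop[OF t] .
  ultimately show ?thesis
    using that t by (cases t) (auto simp: not_less)
qed

text \<open>If the support is exhausted, \<open>S\<close> is empty. Otherwise the budget is spent,
  and the decay factor is at most \<open>exp (- ln \<rho>) = 1 / \<rho>\<close>.\<close>

lemma dual_sum_after_loop:
  assumes c: "set_cover_instance c" and \<rho>: "1 \<le> \<rho>" and x: "lp_feasible c x"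
    and inv: "greedy_invariant c x y B G S"
    and stop: "ln \<rho> * lp_cost c x \<le> total_cost c G \<or> support c x \<subseteq> G"
  shows "\<rho> * (\<Sum>i\<in>S. y i) \<le> lp_cost c x"
proof (cases "support c x \<subseteq> G")
  case True
  then have "S = {}"
    using inv support_covers[OF x] by (auto simp: greedy_invariant_def)
  then show ?thesis using lp_cost_nonneg[OF c x] by simp
next
  case False
  let ?OPT = "lp_cost c x"
  have Y: "(\<Sum>i\<in>S. y i) \<le> ?OPT * exp (- total_cost c G / ?OPT)"
    using inv unfolding greedy_invariant_def by blast
  show ?thesis
  proof (cases "?OPT = 0")
    case True
    then show ?thesis using Y \<rho> by (simp add: mult_nonneg_nonpos)
  next
    case OPT: False
    then have pos: "0 < ?OPT" using lp_cost_nonneg[OF c x] by simp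
    have "ln \<rho> \<le> total_cost c G / ?OPT" using stop False pos by (simp add: field_simps)
    then have "exp (- total_cost c G / ?OPT) \<le> exp (- ln \<rho>)" by simp
    also have "\<dots> = 1 / \<rho>" using \<rho> by (simp add: exp_minus field_simps)
    finally have "?OPT * exp (- total_cost c G / ?OPT) \<le> ?OPT * (1 / \<rho>)"
      using pos by (intro mult_left_mono) auto
    with Y have "(\<Sum>i\<in>S. y i) \<le> ?OPT * (1 / \<rho>)" by (rule order_trans)
    then show ?thesis using \<rho> by (simp add: field_simps)
  qed
qed

theorem theorem2:
  fixes \<Pi> :: "('k, 'i) cover_inst set"
    and APPR :: "('k, 'i) cover_inst \<Rightarrow> 'k set"
    and \<rho> \<delta> OPT :: real
    and c :: "('k, 'i) cover_inst"
    and x :: "'k \<Rightarrow> real" and y :: "'i \<Rightarrow> real"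
    and pick :: "'k set \<Rightarrow> 'k"
  assumes "P_problem \<Pi>"
    and "algorithm_for \<Pi> APPR"
    and "1 \<le> \<rho>"
    and "dual_oblivious \<Pi> APPR \<rho> \<delta>"
    and "c \<in> \<Pi>" and "idx c \<noteq> {}"
    and "oblivious_dual APPR \<rho> \<delta> c y"
    and "lp_optimal c x" and "OPT = lp_cost c x"
    and "greedy_choice c x y pick"
  shows "\<exists>G A. greedy_then_apply \<rho> APPR pick c x = Some (G, A) \<and>
           is_cover c (G \<union> A) \<and>
           total_cost c (G \<union> A) \<le> (ln \<rho> + 1) * OPT + \<delta> + max_cost c"
proof -
  have c: "set_cover_instance c" using assms(1,5) by (simp add: P_problem_def)
  have x: "lp_feasible c x" using assms(8) by (simp add: lp_optimal_def)
  have y: "dual_feasible c y" using assms(7) by (simp add: oblivious_dual_def)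
  obtain G S where
    run: "while_option
       (\<lambda>(G, S). total_cost c G < ln \<rho> * lp_cost c x \<and> \<not> support c x \<subseteq> G)
       (\<lambda>(G, S). (G \<union> {pick G}, S - elems c (pick G))) ({}, ground c) = Some (G, S)"
    and inv: "greedy_invariant c x y (ln \<rho> * lp_cost c x) G S"
    and stop: "ln \<rho> * lp_cost c x \<le> total_cost c G \<or> support c x \<subseteq> G"
    by (rule greedy_loop_terminates[OF c assms(6,3) x y assms(10)])
  let ?A = "APPR (restrict_inst c S)"
  have G: "G \<subseteq> idx c" and S: "S = ground c - (\<Union>k\<in>G. elems c k)"
    and costG: "total_cost c G \<le> ln \<rho> * OPT + max_cost c"
    using inv assms(9) by (auto simp: greedy_invariant_def support_def)
  have Ssub: "S \<subseteq> ground c" using S by blast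
  have "is_cover (restrict_inst c S) ?A"
    using assms(2,5) Ssub by (simp add: algorithm_for_def)
  \<comment> \<open>Indices survive restriction, so \<open>?A\<close> is also a subfamily of
    \<open>c\<close>, and its unrestricted members still cover \<open>S\<close>.\<close>
  then have A: "?A \<subseteq> idx c" and coverS: "S \<subseteq> (\<Union>k\<in>?A. elems c k)"
    unfolding is_cover_def ground_restrict_inst[OF Ssub] by (auto simp: restrict_inst_def)
  have "is_cover c (G \<union> ?A)"
    using G A S coverS by (auto simp: is_cover_def)
  moreover have "total_cost c (G \<union> ?A) \<le> (ln \<rho> + 1) * OPT + \<delta> + max_cost c"
  proof -
    \<comment> \<open>Dual obliviousness is essential here: \<open>y\<close> is fixed in advance,
      while \<open>S\<close> results from a greedy run guided by \<open>y\<close>.\<close>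
    have "total_cost c ?A \<le> \<rho> * (\<Sum>i\<in>S. y i) + \<delta>"
      using assms(7) Ssub by (simp add: oblivious_dual_def)
    then have "total_cost c ?A \<le> OPT + \<delta>"
      using dual_sum_after_loop[OF c assms(3) x inv stop] assms(9) by simp
    then show ?thesis
      using total_cost_Un_le[OF c G A] costG by (simp add: algebra_simps)
  qed
  moreover have "greedy_then_apply \<rho> APPR pick c x = Some (G, ?A)"
    unfolding greedy_then_apply_def run by simp
  ultimately show ?thesis by blast
qed

end
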